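(* Let $N\ge 1$ be an integer. The QMOM-derived moment system $$\partial_t M + A(M)\,\partial_x M = \nu S(M),\qquad M=(M_0,\dots,M_{2N-1})^T\in\mathcal{G},$$ is not strongly hyperbolic.
   Context: QMOM (quadrature method of moments) with $N$ nodes. Let $\mathcal{G}\subset\mathbb{R}^{2N}$ be the set of vectors $M=(M_0,\dots,M_{2N-1})^T$ of the form $$M_j=\sum_{i=1}^N w_i u_i^j,\qquad j=0,\dots,2N-1,$$ with weights $w_i>0$ and pairwise distinct real nodes $u_1,\dots,u_N$. The vector $M\in\mathcal{G}$ determines the pairs $(w_i,u_i)$ up to a common relabeling of the index $i$, so $$\bar M_{2N}=\sum_{i=1}^N w_iu_i^{2N}$$ is a (smooth) function of $M\in\mathcal{G}$. The coefficient matrix $A(M)$ is the $2N\times 2N$ companion-type matrix whose entries in position $(k,k+1)$ equal $1$ for $1\le k\le 2N-1$, whose last row is $(a_0,a_1,\dots,a_{2N-1})$ with $a_j=\partial \bar M_{2N}/\partial M_j$, and whose other entries are zero. The scalar $\nu$ is the collision frequency and the source is $S(M)=\rho(\Delta_0(U,\theta),\dots,\Delta_{2N-1}(U,\theta))^T-M$, where $\rho=M_0$, $\rho U=M_1$, $\rho(U^2+\theta)=\sum_{i}w_iu_i^2$, and $\Delta_j(U,\theta)$ is the $j$th moment of the Gaussian distribution with mean $U$ and variance $\theta$ (the source plays no role in hyperbolicity). The system is called strongly hyperbolic if for every $M\in\mathcal{G}$ the matrix $A(M)$ has only real eigenvalues and is diagonalizable over $\mathbb{R}$. *)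

theory Defs
  imports "HOL-Probability.Probability" "Jordan_Normal_Form.Char_Poly"
begin

unbundle no vec_syntax

text \<open>
  Vectors and matrices are those of Jordan_Normal_Form, so that their size can depend on the number
  of nodes. All indices start at 0, those of the nodes included.
\<close>


subsection \<open>First-order systems and strong hyperbolicity\<close>

text \<open>
  The data of a system \<open>\<partial>\<^sub>t M + A(M) \<partial>\<^sub>x M = R(M)\<close> with \<open>M\<close> ranging over a given state space.
\<close>

record first_order_system =
  state_space :: "real vec set"
  coeff_matrix :: "real vec \<Rightarrow> real mat"
  source_term :: "real vec \<Rightarrow> real vec"

text \<open>Having only real eigenvalues is a statement about the complex spectrum of the real matrix.\<close>

definition only_real_eigenvalues :: "real mat \<Rightarrow> bool" where
  "only_real_eigenvalues A \<longleftrightarrow> (\<forall>z. eigenvalue (map_mat complex_of_real A) z \<longrightarrow> z \<in> \<real>)"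

definition diagonalizable :: "'a::field mat \<Rightarrow> bool" where
  "diagonalizable A \<longleftrightarrow> (\<exists>D. diagonal_mat D \<and> similar_mat A D)"

definition strongly_hyperbolic :: "first_order_system \<Rightarrow> bool" where
  "strongly_hyperbolic S \<longleftrightarrow>
     (\<forall>M \<in> state_space S. only_real_eigenvalues (coeff_matrix S M) \<and>
                          diagonalizable (coeff_matrix S M))"


subsection \<open>The QMOM moment system\<close>

definition node_moment :: "nat \<Rightarrow> (nat \<Rightarrow> real) \<Rightarrow> (nat \<Rightarrow> real) \<Rightarrow> nat \<Rightarrow> real" where
  "node_moment N w u j = (\<Sum>i<N. w i * u i ^ j)"

definition quadrature_of :: "nat \<Rightarrow> real vec \<Rightarrow> (nat \<Rightarrow> real) \<Rightarrow> (nat \<Rightarrow> real) \<Rightarrow> bool" where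
  "quadrature_of N M w u \<longleftrightarrow>
     (\<forall>i<N. w i > 0) \<and> inj_on u {..<N} \<and> M = vec (2 * N) (node_moment N w u)"

definition qmom_states :: "nat \<Rightarrow> real vec set" where
  "qmom_states N = {M. \<exists>w u. quadrature_of N M w u}"

text \<open>
  The \<open>j\<close>-th moment of the quadrature determined by \<open>M\<close>, for arbitrary \<open>j\<close>. It is well defined on
  \<open>qmom_states N\<close>, where weights and nodes are unique up to relabeling; elsewhere the value is
  unspecified.
\<close>

definition quadrature_moment :: "nat \<Rightarrow> real vec \<Rightarrow> nat \<Rightarrow> real" where
  "quadrature_moment N M j = (THE m. \<exists>w u. quadrature_of N M w u \<and> m = node_moment N w u j)"

definition closure_moment :: "nat \<Rightarrow> real vec \<Rightarrow> real" where
  "closure_moment N M = quadrature_moment N M (2 * N)"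

definition partial_deriv :: "(real vec \<Rightarrow> real) \<Rightarrow> nat \<Rightarrow> real vec \<Rightarrow> real" where
  "partial_deriv f j M = deriv (\<lambda>t. f (update_vec M j t)) (M $ j)"

definition qmom_matrix :: "nat \<Rightarrow> real vec \<Rightarrow> real mat" where
  "qmom_matrix N M = mat (2 * N) (2 * N) (\<lambda>(k, l).
     if k = 2 * N - 1 then partial_deriv (closure_moment N) l M
     else if l = k + 1 then 1 else 0)"

text \<open>
  For variance 0, which always occurs when there is a single node, the Gaussian is the point mass at
  the mean; the library function \<open>normal_density\<close> is identically 0 in this case.
\<close>

definition gaussian :: "real \<Rightarrow> real \<Rightarrow> real measure" where
  "gaussian U \<theta> = (if \<theta> = 0 then return borel U else density lborel (normal_density U (sqrt \<theta>)))"

definition gaussian_moment :: "real \<Rightarrow> real \<Rightarrow> nat \<Rightarrow> real" where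
  "gaussian_moment U \<theta> j = (\<integral>x. x ^ j \<partial>gaussian U \<theta>)"

definition qmom_source :: "nat \<Rightarrow> real vec \<Rightarrow> real vec" where
  "qmom_source N M =
     (let \<rho> = M $ 0;
          U = M $ 1 / \<rho>;
          \<theta> = quadrature_moment N M 2 / \<rho> - U ^ 2
      in \<rho> \<cdot>\<^sub>v vec (2 * N) (gaussian_moment U \<theta>) - M)"

definition qmom_system :: "nat \<Rightarrow> real \<Rightarrow> first_order_system" where
  "qmom_system N \<nu> =
     \<lparr>state_space = qmom_states N,
      coeff_matrix = qmom_matrix N,
      source_term = (\<lambda>M. \<nu> \<cdot>\<^sub>v qmom_source N M)\<rparr>"

end

theory Submission
  imports Defs "HOL-Homology.Invariance_of_Domain"
begin

unbundle no vec_syntax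
hide_const (open) up_ring.coeff up_ring.monom

text \<open>
  At every state the characteristic polynomial of the coefficient matrix is the square of the nodal
  polynomial \<open>(x - u\<^sub>1) \<dots> (x - u\<^sub>N)\<close>. The eigenvalues are therefore the nodes, all real, but each of
  them is a double root, and a companion matrix has only a line of eigenvectors for each eigenvalue.
  So diagonalizability fails everywhere in the state space.

  The work lies in computing the gradient of the closure moment, which is defined only implicitly. For
  any \<open>v\<close> write \<open>Q\<^sub>v(x) = \<Prod>\<^sub>i (x - v\<^sub>i)\<^sup>2 = x\<^sup>2\<^sup>N - \<Sum>\<^sub>j b\<^sub>j(v) x\<^sup>j\<close>. Since \<open>Q\<^sub>v\<close> is nonnegative, integrating
  it against a quadrature for \<open>M\<close> shows that the closure moment is at least
  \<open>\<Sum>\<^sub>j b\<^sub>j(v) M\<^sub>j\<close>, with equality if \<open>v\<close> consists of the nodes of \<open>M\<close> itself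
  (\<open>support_functional_le\<close>, \<open>support_functional_own_nodes\<close>). The closure moment is thus a maximum of
  linear functions of \<open>M\<close>. This has two consequences. It depends only on \<open>M\<close>, whichever quadrature is
  used to compute it. And \<open>b(u)\<close>, for the nodes \<open>u\<close> of \<open>M\<close>, is a subgradient at \<open>M\<close>; a function
  whose subgradient can be chosen continuously is differentiable with that gradient, because its
  difference quotients are squeezed between the subgradients at the two end points.

  Hence it is enough to know that states near \<open>M\<close> have quadratures with nodes near those of \<open>M\<close>. The
  map from weights and nodes to the \<open>2N\<close> moments is continuous, and it is injective as long as the
  nodes stay close to \<open>u\<close>; by invariance of domain it is open (\<open>quadrature_perturbation\<close>).
\<close>

section \<open>Companion matrices with a double root\<close>

text \<open>
  In a basis that diagonalizes \<open>A\<close>, the relation \<open>A y = c y + x\<close> reads \<open>(d\<^sub>i - c) y\<^sub>i = x\<^sub>i\<close> in each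
  coordinate, while \<open>A x = c x\<close> reads \<open>(d\<^sub>i - c) x\<^sub>i = 0\<close>. Together they force \<open>x = 0\<close>.
\<close>

lemma not_diagonalizable_if_generalized_eigenvector:
  fixes A :: "'a::field mat"
  assumes A: "A \<in> carrier_mat n n" and x: "x \<in> carrier_vec n" and y: "y \<in> carrier_vec n"
    and Ax: "A *\<^sub>v x = c \<cdot>\<^sub>v x" and Ay: "A *\<^sub>v y = c \<cdot>\<^sub>v y + x" and x0: "x \<noteq> 0\<^sub>v n"
  shows "\<not> diagonalizable A"
proof
  assume "diagonalizable A"
  then obtain D P Q where D: "diagonal_mat D" and sim: "similar_mat_wit A D P Q"
    unfolding diagonalizable_def similar_mat_def by blast
  note s = similar_mat_witD2[OF A sim]
  have QA: "Q * A = D * Q"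
  proof -
    have "Q * A = Q * (P * (D * Q))"
      unfolding s(3) by (subst assoc_mult_mat[OF s(6) s(5) s(7)]) (rule refl)
    also have "\<dots> = (Q * P) * (D * Q)"
      by (rule assoc_mult_mat[OF s(7) s(6) mult_carrier_mat[OF s(5) s(7)], symmetric])
    also have "\<dots> = D * Q"
      unfolding s(2) by (rule left_mult_one_mat[OF mult_carrier_mat[OF s(5) s(7)]])
    finally show ?thesis .
  qed
  have D_mult: "(D *\<^sub>v z) $ i = D $$ (i, i) * z $ i" if "z \<in> carrier_vec n" "i < n" for z i
  proof -
    have "(D *\<^sub>v z) $ i = (\<Sum>k<n. D $$ (i, k) * z $ k)"
      using s(5) that by (auto simp: scalar_prod_def lessThan_atLeast0 intro!: sum.cong)
    also have "\<dots> = (\<Sum>k\<in>{i}. D $$ (i, k) * z $ k)"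
      using s(5) that D by (intro sum.mono_neutral_right) (auto simp: diagonal_mat_def)
    finally show ?thesis by simp
  qed
  define x' y' where "x' = Q *\<^sub>v x" and "y' = Q *\<^sub>v y"
  have x'y': "x' \<in> carrier_vec n" "y' \<in> carrier_vec n"
    unfolding x'_def y'_def using s(7) x y by auto
  have "D *\<^sub>v x' = Q *\<^sub>v (A *\<^sub>v x)"
    unfolding x'_def by (simp only: QA assoc_mult_mat_vec[OF s(5) s(7) x, symmetric]
        assoc_mult_mat_vec[OF s(7) A x, symmetric])
  then have Dx: "D *\<^sub>v x' = c \<cdot>\<^sub>v x'"
    unfolding Ax x'_def using mult_mat_vec[OF s(7) x] by simp
  have "D *\<^sub>v y' = Q *\<^sub>v (A *\<^sub>v y)"
    unfolding y'_def by (simp only: QA assoc_mult_mat_vec[OF s(5) s(7) y, symmetric]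
        assoc_mult_mat_vec[OF s(7) A y, symmetric])
  then have Dy: "D *\<^sub>v y' = c \<cdot>\<^sub>v y' + x'"
    unfolding Ay y'_def x'_def
    using x y mult_mat_vec[OF s(7) y] mult_add_distrib_mat_vec[OF s(7), of "c \<cdot>\<^sub>v y" x] by simp
  have "x' $ i = 0" if "i < n" for i
  proof -
    have 1: "D $$ (i, i) * x' $ i = c * x' $ i"
      using D_mult[OF x'y'(1) that, symmetric] x'y' that by (simp add: Dx)
    have 2: "D $$ (i, i) * y' $ i = c * y' $ i + x' $ i"
      using D_mult[OF x'y'(2) that] x'y' that by (simp add: Dy)
    show ?thesis using 1 2 by (metis add_cancel_right_right mult_right_cancel)
  qed
  then have "x' = 0\<^sub>v n" using x'y' by auto
  moreover have "x = P *\<^sub>v x'"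
    unfolding x'_def assoc_mult_mat_vec[OF s(6) s(7) x, symmetric] s(1) using x by simp
  ultimately show False using x0 s(6) by auto
qed

text \<open>
  The vector of powers of \<open>a\<close> is an eigenvector because \<open>p\<close> vanishes at \<open>a\<close>. Differentiating this
  relation in \<open>a\<close> yields a generalized eigenvector, whose last row holds because \<open>p'\<close> vanishes too.
\<close>

lemma companion_not_diagonalizable:
  fixes p :: "'a::field poly"
  assumes deg: "degree p = n" and monic: "lead_coeff p = 1" and dvd: "[:- a, 1:]\<^sup>2 dvd p"
  shows "\<not> diagonalizable (mat n n (\<lambda>(k, l).
           if k = n - 1 then - coeff p l else if l = k + 1 then 1 else 0))" (is "\<not> diagonalizable ?A")
proof -
  have p0: "p \<noteq> 0" using monic by auto
  have n: "n \<ge> 2"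
    using dvd_imp_degree_le[OF dvd p0] deg by (simp add: degree_power_eq)
  have cn: "coeff p n = 1" using monic deg by simp
  obtain r where r: "p = [:- a, 1:]\<^sup>2 * r" using dvd by blast
  have "poly p a = 0" unfolding r by simp
  then have "(\<Sum>i\<le>n. coeff p i * a ^ i) = 0" unfolding poly_altdef deg .
  then have root: "(\<Sum>i<n. coeff p i * a ^ i) = - (a ^ n)"
    by (simp add: lessThan_Suc_atMost[symmetric] cn eq_neg_iff_add_eq_0)
  have "poly (pderiv p) a = 0"
    unfolding r power2_eq_square by (simp only: pderiv_mult) (simp add: pderiv_pCons)
  moreover have "pderiv p = (\<Sum>i\<le>n. monom (of_nat i * coeff p i) (i - 1))"
    by (subst poly_as_sum_of_monoms[of p, symmetric])
       (simp add: deg pderiv_sum pderiv_monom)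
  ultimately have "(\<Sum>i\<le>n. of_nat i * coeff p i * a ^ (i - 1)) = 0"
    by (simp add: poly_sum poly_monom)
  then have root': "(\<Sum>i<n. of_nat i * coeff p i * a ^ (i - 1)) = - (of_nat n * a ^ (n - 1))"
    by (simp add: lessThan_Suc_atMost[symmetric] cn eq_neg_iff_add_eq_0)
  define x y where "x = vec n (\<lambda>j. a ^ j)" and "y = vec n (\<lambda>j. of_nat j * a ^ (j - 1))"
  have row: "(?A *\<^sub>v z) $ k = (if k = n - 1 then - (\<Sum>l<n. coeff p l * z $ l) else z $ (k + 1))"
    if z: "z \<in> carrier_vec n" and k: "k < n" for z k
  proof -
    have eq: "(?A *\<^sub>v z) $ k =
        (\<Sum>l<n. (if k = n - 1 then - coeff p l else if l = k + 1 then 1 else 0) * z $ l)"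
      using z k by (auto simp: scalar_prod_def lessThan_atLeast0 intro!: sum.cong)
    show ?thesis
    proof (cases "k = n - 1")
      case True
      then show ?thesis unfolding eq by (simp add: sum_negf)
    next
      case False
      then have "(?A *\<^sub>v z) $ k = (\<Sum>l<n. if l = k + 1 then z $ l else 0)"
        by (intro trans[OF eq] sum.cong) auto
      then show ?thesis using False k by simp
    qed
  qed
  have pow: "a ^ n = a * a ^ (n - 1)" "a ^ (n - 1) = a * a ^ (n - 1 - 1)"
    using n by (metis add_2_eq_Suc diff_Suc_1 le_Suc_ex power_Suc)+
  show ?thesis
  proof (rule not_diagonalizable_if_generalized_eigenvector)
    show "?A \<in> carrier_mat n n" "x \<in> carrier_vec n" "y \<in> carrier_vec n"
      by (simp_all add: x_def y_def)
    show "?A *\<^sub>v x = a \<cdot>\<^sub>v x"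
    proof (rule eq_vecI)
      fix k assume "k < dim_vec (a \<cdot>\<^sub>v x)"
      then have k: "k < n" by (simp add: x_def)
      show "(?A *\<^sub>v x) $ k = (a \<cdot>\<^sub>v x) $ k"
        using k pow by (subst row) (auto simp: x_def root)
    qed (simp add: x_def)
    show "?A *\<^sub>v y = a \<cdot>\<^sub>v y + x"
    proof (rule eq_vecI)
      fix k assume "k < dim_vec (a \<cdot>\<^sub>v y + x)"
      then have k: "k < n" by (simp add: x_def)
      have last: "(\<Sum>l<n. coeff p l * y $ l) = - (of_nat n * a ^ (n - 1))"
        unfolding root'[symmetric] by (intro sum.cong) (auto simp: y_def mult_ac)
      show "(?A *\<^sub>v y) $ k = (a \<cdot>\<^sub>v y + x) $ k"
      proof (cases "k = n - 1")
        case True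
        have "of_nat n = 1 + (of_nat (n - 1) :: 'a)" using n by (simp add: of_nat_diff)
        then have "of_nat n * a ^ (n - 1) = a * (of_nat (n - 1) * a ^ (n - 1 - 1)) + a ^ (n - 1)"
          using pow(2) by (simp only: distrib_right) (simp add: mult_ac)
        then show ?thesis using True k n
          by (subst row) (simp_all add: last, simp_all add: x_def y_def)
      next
        case False
        then have k1: "k + 1 < n" using k by simp
        have "of_nat (k + 1) * a ^ k = a * (of_nat k * a ^ (k - 1)) + a ^ k"
          by (cases k) (simp_all add: algebra_simps)
        then show ?thesis using False k k1
          by (subst row) (simp_all add: x_def y_def)
      qed
    qed (simp add: x_def)
    have "x $ 0 = 1" using n by (simp add: x_def)
    then show "x \<noteq> 0\<^sub>v n" using n by auto
  qed
qed


section \<open>The closure moment as a maximum of linear functions\<close>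

definition nodal_square :: "nat \<Rightarrow> (nat \<Rightarrow> real) \<Rightarrow> real poly" where
  "nodal_square N v = (\<Prod>i<N. [:- v i, 1:])\<^sup>2"

lemma degree_nodal_square: "degree (nodal_square N v) = 2 * N"
  by (simp add: nodal_square_def degree_power_eq degree_prod_sum_eq)

lemma coeff_nodal_square_top: "coeff (nodal_square N v) (2 * N) = 1"
  using monic_power[of "\<Prod>i<N. [:- v i, 1:]" 2] monic_prod[of "{..<N}" "\<lambda>i. [:- v i, 1:]"]
  by (simp add: nodal_square_def[symmetric] degree_nodal_square)

lemma poly_nodal_square: "poly (nodal_square N v) x = (\<Prod>i<N. x - v i)\<^sup>2"
  by (simp add: nodal_square_def poly_prod)

text \<open>Integrating a polynomial against the quadrature only uses the moments.\<close>

lemma weighted_sum_poly_eq: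
  "(\<Sum>i<N. w i * poly p (u i)) = (\<Sum>j\<le>degree p. coeff p j * node_moment N w u j)"
  unfolding poly_altdef node_moment_def sum_distrib_left
  by (subst sum.swap) (simp add: mult_ac)

text \<open>
  Integrating \<open>nodal_square N v\<close> without its leading term, and with the opposite sign, against any
  measure with moments \<open>M\<close>.
\<close>

definition support_functional :: "nat \<Rightarrow> (nat \<Rightarrow> real) \<Rightarrow> real vec \<Rightarrow> real" where
  "support_functional N v M = - (\<Sum>j<2 * N. coeff (nodal_square N v) j * M $ j)"

text \<open>The right-hand side is the integral of \<open>nodal_square N v\<close> against the quadrature.\<close>

lemma closure_gap:
  assumes "quadrature_of N M w u"
  shows "node_moment N w u (2 * N) - support_functional N v M
           = (\<Sum>i<N. w i * (\<Prod>k<N. u i - v k)\<^sup>2)"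
proof -
  have M: "M $ j = node_moment N w u j" if "j < 2 * N" for j
    using assms that by (simp add: quadrature_of_def)
  show ?thesis
    using weighted_sum_poly_eq[where p = "nodal_square N v" and N = N and w = w and u = u]
    by (simp add: poly_nodal_square degree_nodal_square lessThan_Suc_atMost[symmetric]
          coeff_nodal_square_top support_functional_def M)
qed

lemma support_functional_le:
  assumes "quadrature_of N M w u"
  shows "support_functional N v M \<le> node_moment N w u (2 * N)"
proof -
  have "0 \<le> (\<Sum>i<N. w i * (\<Prod>k<N. u i - v k)\<^sup>2)"
    using assms by (intro sum_nonneg mult_nonneg_nonneg) (auto simp: quadrature_of_def less_imp_le)
  then show ?thesis using closure_gap[OF assms, of v] by simp
qed

lemma support_functional_own_nodes:
  assumes "quadrature_of N M w u"
  shows "support_functional N u M = node_moment N w u (2 * N)"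
proof -
  have "(\<Sum>i<N. w i * (\<Prod>k<N. u i - u k)\<^sup>2) = 0"
    by (rule sum.neutral) auto
  then show ?thesis using closure_gap[OF assms, of u] by simp
qed

text \<open>
  Two quadratures of the same state bound each other's top moment from below, each through the
  functional at its own nodes; this is what makes the closure moment well defined.
\<close>

lemma closure_moment_eq:
  assumes "quadrature_of N M w u"
  shows "closure_moment N M = node_moment N w u (2 * N)"
  unfolding closure_moment_def quadrature_moment_def
proof (rule the_equality)
  fix m assume "\<exists>w u. quadrature_of N M w u \<and> m = node_moment N w u (2 * N)"
  then obtain w' u' where *: "quadrature_of N M w' u'" "m = node_moment N w' u' (2 * N)" by blast
  show "m = node_moment N w u (2 * N)"
    using support_functional_le[OF assms, of u'] support_functional_le[OF *(1), of u]
      support_functional_own_nodes[OF assms] support_functional_own_nodes[OF *(1)] *(2) by simp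
qed (use assms in blast)

text \<open>
  The second quadrature integrates the nonnegative polynomial \<open>nodal_square N u\<close> to zero, so all its
  nodes are zeros of it.
\<close>

lemma quadrature_nodes_unique:
  assumes q: "quadrature_of N M w u" and q': "quadrature_of N M w' u'" and i: "i < N"
  obtains k where "k < N" "u' i = u k"
proof -
  have "(\<Sum>i<N. w' i * (\<Prod>k<N. u' i - u k)\<^sup>2) = 0"
    using closure_gap[OF q', of u] support_functional_own_nodes[OF q]
      closure_moment_eq[OF q] closure_moment_eq[OF q'] by simp
  then have "w' i * (\<Prod>k<N. u' i - u k)\<^sup>2 = 0"
    using q' i by (subst (asm) sum_nonneg_eq_0_iff) (auto simp: quadrature_of_def less_imp_le)
  then show ?thesis using q' i that by (auto simp: quadrature_of_def)
qed

lemma quadrature_weights_unique: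
  assumes q: "quadrature_of N M w u" and q': "quadrature_of N M w' u" and i: "i < N"
  shows "w' i = w i"
proof -
  \<comment> \<open>Vanishing at all nodes but the \<open>i\<close>-th, \<open>p\<close> isolates the \<open>i\<close>-th weight when integrated.\<close>
  define p where "p = (\<Prod>k\<in>{..<N} - {i}. [:- u k, 1:])"
  have deg: "degree p < 2 * N" using i by (simp add: p_def degree_prod_sum_eq)
  have p_i: "poly p (u i) \<noteq> 0"
    using q i by (auto simp: p_def poly_prod quadrature_of_def inj_on_def)
  have p_j: "poly p (u j) = 0" if "j < N" "j \<noteq> i" for j
    unfolding p_def poly_prod using that by (intro prod_zero) (auto intro!: bexI[of _ j])
  have pick: "(\<Sum>j<N. v j * poly p (u j)) = v i * poly p (u i)" for v :: "nat \<Rightarrow> real"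
  proof -
    have "(\<Sum>j<N. v j * poly p (u j)) = (\<Sum>j\<in>{i}. v j * poly p (u j))"
      using i p_j by (intro sum.mono_neutral_right) auto
    then show ?thesis by simp
  qed
  have "node_moment N w u j = node_moment N w' u j" if "j \<le> degree p" for j
  proof -
    have j: "j < 2 * N" using that deg by simp
    have "vec (2 * N) (node_moment N w u) $ j = vec (2 * N) (node_moment N w' u) $ j"
      using q q' unfolding quadrature_of_def by metis
    then show ?thesis using j by simp
  qed
  then have "(\<Sum>j<N. w j * poly p (u j)) = (\<Sum>j<N. w' j * poly p (u j))"
    unfolding weighted_sum_poly_eq by simp
  then show ?thesis using p_i by (simp add: pick)
qed


section \<open>Perturbation of a quadrature\<close>

lemma nodes_separated:
  fixes u :: "nat \<Rightarrow> real"
  assumes "inj_on u {..<N}"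
  obtains \<delta> where "\<delta> > 0" "\<And>i k. i < N \<Longrightarrow> k < N \<Longrightarrow> \<bar>u i - u k\<bar> < 2 * \<delta> \<Longrightarrow> i = k"
proof -
  define S where "S = insert 1 ((\<lambda>(i, k). \<bar>u i - u k\<bar>) ` {(i, k). i < N \<and> k < N \<and> i \<noteq> k})"
  have "finite {(i, k). i < N \<and> k < N \<and> i \<noteq> k}"
    by (rule finite_subset[of _ "{..<N} \<times> {..<N}"]) auto
  then have fin: "finite S" by (simp add: S_def)
  show ?thesis
  proof (rule that[of "Min S / 2"])
    show "Min S / 2 > 0"
      using fin assms by (auto simp: S_def inj_on_def)
    fix i k assume ik: "i < N" "k < N" "\<bar>u i - u k\<bar> < 2 * (Min S / 2)"
    show "i = k"
    proof (rule ccontr)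
      assume "i \<noteq> k"
      then have "\<bar>u i - u k\<bar> \<in> S" using ik by (auto simp: S_def image_iff)
      then have "Min S \<le> \<bar>u i - u k\<bar>" by (rule Min_le[OF fin])
      then show False using ik by simp
    qed
  qed
qed

lemma openin_Euclidean_space_open_Int:
  "open V \<Longrightarrow> openin (Euclidean_space n) (topspace (Euclidean_space n) \<inter> V)"
  unfolding topspace_Euclidean_space
  by (simp add: Euclidean_space_def euclidean_product_topology openin_open_Int)

text \<open>
  Weights and nodes are packed into one vector of length \<open>2N\<close>, weights first. Restricting the nodes
  to disjoint intervals around those of \<open>u\<close> removes the freedom of relabeling, so that the moment map
  becomes injective and invariance of domain applies. The neighbourhood \<open>W\<close> lives in the product
  topology on infinite sequences; beyond the first \<open>N\<close> entries the perturbed nodes agree with \<open>u\<close>.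
\<close>

lemma quadrature_perturbation:
  assumes q: "quadrature_of N M w u" and l: "l < 2 * N" and W: "open W" "u \<in> W"
  shows "\<forall>\<^sub>F t in nhds (M $ l). \<exists>w' u'. quadrature_of N (update_vec M l t) w' u' \<and> u' \<in> W"
proof -
  obtain \<delta> where \<delta>: "\<delta> > 0" "\<And>i k. i < N \<Longrightarrow> k < N \<Longrightarrow> \<bar>u i - u k\<bar> < 2 * \<delta> \<Longrightarrow> i = k"
    by (rule nodes_separated[of u N]) (use q in \<open>auto simp: quadrature_of_def\<close>)
  define nodes :: "(nat \<Rightarrow> real) \<Rightarrow> nat \<Rightarrow> real"
    where "nodes x i = (if i < N then x (N + i) else u i)" for x i
  define V where "V = (\<Inter>i<N. {x. 0 < x i}) \<inter> (\<Inter>i<N. {x. \<bar>x (N + i) - u i\<bar> < \<delta>}) \<inter> nodes -` W"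
  define U where "U = topspace (Euclidean_space (2 * N)) \<inter> V"
  define F where "F x j = (if j < 2 * N then node_moment N x (nodes x) j else 0)"
    for x :: "nat \<Rightarrow> real" and j
  define state where "state x = vec (2 * N) (node_moment N x (nodes x))" for x
  have coord: "continuous_on S (\<lambda>x :: nat \<Rightarrow> real. x i)" for i S
    by (rule continuous_on_subset[OF continuous_on_product_coordinates subset_UNIV])
  have cont_nodes_i: "continuous_on S (\<lambda>x. nodes x i)" for i S
    unfolding nodes_def by (cases "i < N") (auto intro: coord)
  have "open (nodes -` W)"
    by (intro open_vimage[OF W(1)] continuous_on_coordinatewise_then_product cont_nodes_i)
  then have "open V"
    unfolding V_def
    by (intro open_Int open_INT ballI finite_lessThan open_Collect_less
        continuous_on_const continuous_on_rabs continuous_on_diff coord)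
  then have open_U: "openin (Euclidean_space (2 * N)) U"
    unfolding U_def by (rule openin_Euclidean_space_open_Int)
  have sep: "i = k" if "x \<in> U" "y \<in> U" "i < N" "k < N" "nodes x i = nodes y k" for x y i k
  proof (rule \<delta>(2)[OF that(3,4)])
    have "\<bar>nodes x i - u i\<bar> < \<delta>" "\<bar>nodes y k - u k\<bar> < \<delta>"
      using that(1-4) by (auto simp: U_def V_def nodes_def)
    then show "\<bar>u i - u k\<bar> < 2 * \<delta>" using that(5) by linarith
  qed
  have quad: "quadrature_of N (state x) x (nodes x)" if "x \<in> U" for x
    using that sep[of x x] by (auto simp: quadrature_of_def state_def U_def V_def inj_on_def)
  have "continuous_on S (\<lambda>x. F x j)" for j S
    unfolding F_def node_moment_def
    by (cases "j < 2 * N") (auto intro!: continuous_intros coord cont_nodes_i)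
  then have "continuous_on S F" for S
    by (intro continuous_on_coordinatewise_then_product)
  then have "continuous_map (subtopology (Euclidean_space (2 * N)) U) (Euclidean_space (2 * N)) F"
    unfolding cm_Euclidean_space_iff_continuous_on by (auto simp: topspace_Euclidean_space F_def)
  moreover have "inj_on F U"
  proof (rule inj_onI)
    fix x y assume xy: "x \<in> U" "y \<in> U" "F x = F y"
    have "state x = state y"
      using xy(3) by (auto simp: state_def F_def fun_eq_iff intro!: eq_vecI) (metis)
    then have qy: "quadrature_of N (state x) y (nodes y)" using quad[OF xy(2)] by simp
    have nodes_eq: "nodes y i = nodes x i" if i: "i < N" for i
      using quadrature_nodes_unique[OF quad[OF xy(1)] qy i] sep[OF xy(2,1) i] by metis
    then have "nodes y = nodes x" by (auto simp: nodes_def fun_eq_iff)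
    then have w_eq: "y i = x i" if "i < N" for i
      using quadrature_weights_unique[OF quad[OF xy(1)] _ that] qy by simp
    show "x = y"
    proof
      fix i
      consider "i < N" | k where "k < N" "i = N + k" | "i \<ge> 2 * N"
        by (metis add.commute add_diff_inverse_nat add_less_cancel_right mult_2 not_le)
      then show "x i = y i"
      proof cases
        case 2
        then show ?thesis using nodes_eq[of k] by (simp add: nodes_def)
      next
        case 3
        then show ?thesis using xy by (simp add: U_def topspace_Euclidean_space)
      qed (simp add: w_eq)
    qed
  qed
  ultimately have "openin (Euclidean_space (2 * N)) (F ` U)"
    by (rule invariance_of_domain_Euclidean_space[OF open_U])
  then obtain T where T: "open T" "F ` U = topspace (Euclidean_space (2 * N)) \<inter> T"
    unfolding Euclidean_space_def euclidean_product_topology topspace_Euclidean_space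
    by (auto simp: openin_open)
  define line where "line t j = (if j < 2 * N then update_vec M l t $ j else 0)" for t j
  have M: "dim_vec M = 2 * N" "M = vec (2 * N) (node_moment N w u)"
    using q by (auto simp: quadrature_of_def)
  have "continuous_on UNIV (\<lambda>t. line t j)" for j
    unfolding line_def using M(1) by (cases "j = l"; cases "j < 2 * N") auto
  then have "continuous_on UNIV line" by (rule continuous_on_coordinatewise_then_product)
  then have "open (line -` T)" using T(1) by (rule open_vimage[rotated])
  moreover have "M $ l \<in> line -` T"
  proof -
    define x where "x i = (if i < N then w i else if i < 2 * N then u (i - N) else 0)" for i
    have nx: "nodes x = u" by (auto simp: nodes_def x_def)
    have "x \<in> U"
      using q W(2) \<delta>(1) nx by (auto simp: U_def V_def topspace_Euclidean_space x_def quadrature_of_def)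
    moreover have "F x = line (M $ l)"
    proof
      fix j
      have "node_moment N x u j = node_moment N w u j" by (simp add: node_moment_def x_def)
      moreover have "update_vec M l (M $ l) $ j = M $ j" using l M(1) by (cases "j = l") auto
      ultimately show "F x j = line (M $ l) j"
        using M(2) by (simp add: F_def nx line_def)
    qed
    ultimately show ?thesis using T(2) by (metis IntD2 imageI vimageI2)
  qed
  ultimately have "\<forall>\<^sub>F t in nhds (M $ l). t \<in> line -` T" by (rule eventually_nhds_in_open)
  then show ?thesis
  proof eventually_elim
    case (elim t)
    then have "line t \<in> F ` U"
      unfolding T(2) by (simp add: topspace_Euclidean_space line_def)
    then obtain x where x: "x \<in> U" "line t = F x" by auto
    have "state x = update_vec M l t"
    proof (rule eq_vecI)
      fix j assume "j < dim_vec (update_vec M l t)"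
      then have j: "j < 2 * N" using M(1) by simp
      then show "state x $ j = update_vec M l t $ j"
        using fun_cong[OF x(2), of j] by (simp add: line_def F_def state_def)
    qed (simp add: state_def M(1))
    then show ?case using quad[OF x(1)] x(1) by (auto simp: U_def V_def)
  qed
qed


section \<open>The gradient of the closure moment\<close>

lemma continuous_coeff_nodal_square: "continuous_on UNIV (\<lambda>v. coeff (nodal_square N v) j)"
proof -
  have coord: "continuous_on UNIV (\<lambda>x :: nat \<Rightarrow> real. x i)" for i
    by (rule continuous_on_product_coordinates)
  have "continuous_on UNIV (\<lambda>v :: nat \<Rightarrow> real. coeff (\<Prod>i<n. [:- v i, 1:]) j)" for n j :: nat
  proof (induction n arbitrary: j)
    case (Suc n)
    have "coeff [:- v n, 1:] k = (if k = 0 then - v n else if k = 1 then 1 else 0)"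
      for v :: "nat \<Rightarrow> real" and k
      by (auto simp: coeff_pCons split: nat.splits)
    then have linear: "continuous_on UNIV (\<lambda>v :: nat \<Rightarrow> real. coeff [:- v n, 1:] k)" for k
      by (cases "k = 0") (auto intro!: continuous_intros coord)
    show ?case
      unfolding prod.lessThan_Suc coeff_mult by (intro continuous_intros Suc.IH linear)
  qed simp
  then show ?thesis
    unfolding nodal_square_def power2_eq_square coeff_mult by (intro continuous_intros)
qed

lemma support_functional_update:
  assumes "dim_vec M = 2 * N" "l < 2 * N"
  shows "support_functional N v (update_vec M l t)
           = support_functional N v M - coeff (nodal_square N v) l * (t - M $ l)"
proof -
  have "(\<Sum>j<2 * N. coeff (nodal_square N v) j * update_vec M l t $ j)
      = (\<Sum>j<2 * N. coeff (nodal_square N v) j * M $ j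
           + (if j = l then coeff (nodal_square N v) l * (t - M $ l) else 0))"
    using assms by (intro sum.cong) (auto simp: algebra_simps)
  then show ?thesis
    using assms(2) by (simp add: support_functional_def sum.distrib)
qed

text \<open>
  Moving \<open>M\<^sub>l\<close> by \<open>h\<close> changes the closure moment by at least \<open>b(u) h\<close>, the support functional of the
  old nodes being a lower bound at the new state, and by at most \<open>b(u') h\<close>, by the same argument with
  the states exchanged. The new nodes \<open>u'\<close> tend to \<open>u\<close>, hence \<open>b(u')\<close> to \<open>b(u)\<close>.
\<close>

lemma partial_deriv_closure_moment:
  assumes q: "quadrature_of N M w u" and l: "l < 2 * N"
  shows "partial_deriv (closure_moment N) l M = - coeff (nodal_square N u) l"
proof -
  define b where "b v = - coeff (nodal_square N v) l" for v
  define f where "f t = closure_moment N (update_vec M l t)" for t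
  have dim: "dim_vec M = 2 * N" using q by (simp add: quadrature_of_def)
  note upd = support_functional_update[OF dim l]
  have fM: "f (M $ l) = support_functional N u M"
  proof -
    have "update_vec M l (M $ l) = M" using l dim by (intro eq_vecI) (auto simp: update_vec_def)
    then show ?thesis
      using closure_moment_eq[OF q] support_functional_own_nodes[OF q] by (simp add: f_def)
  qed
  have "((\<lambda>t. (f t - f (M $ l)) / (t - M $ l)) \<longlongrightarrow> b u) (at (M $ l))"
  proof (rule tendstoI)
    fix e :: real assume e: "e > 0"
    define W where "W = {v. \<bar>b v - b u\<bar> < e}"
    have "open W"
      unfolding W_def b_def
      by (intro open_Collect_less continuous_intros continuous_coeff_nodal_square)
    moreover have "u \<in> W" using e by (simp add: W_def)
    ultimately have "\<forall>\<^sub>F t in at (M $ l). \<exists>w' u'. quadrature_of N (update_vec M l t) w' u' \<and> u' \<in> W"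
      using quadrature_perturbation[OF q l] eventually_nhds_conv_at by blast
    then show "\<forall>\<^sub>F t in at (M $ l). dist ((f t - f (M $ l)) / (t - M $ l)) (b u) < e"
      using eventually_neq_at_within[of "M $ l"]
    proof eventually_elim
      case (elim t)
      then obtain w' u' where q': "quadrature_of N (update_vec M l t) w' u'" and u': "u' \<in> W"
        by blast
      define h where "h = t - M $ l"
      have ft: "f t = support_functional N u' (update_vec M l t)"
        using closure_moment_eq[OF q'] support_functional_own_nodes[OF q'] by (simp add: f_def)
      have "b u * h \<le> f t - f (M $ l)"
        using support_functional_le[OF q', of u] support_functional_own_nodes[OF q'] ft fM
        by (simp add: upd b_def h_def)
      moreover have "f t - f (M $ l) \<le> b u' * h"
        using support_functional_le[OF q, of u'] support_functional_own_nodes[OF q] ft fM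
        by (simp add: upd b_def h_def)
      ultimately have "\<bar>f t - f (M $ l) - b u * h\<bar> \<le> \<bar>(b u' - b u) * h\<bar>"
        by (simp add: left_diff_distrib)
      moreover have h: "h \<noteq> 0" using elim by (simp add: h_def)
      moreover have "(f t - f (M $ l)) / h - b u = (f t - f (M $ l) - b u * h) / h"
        using h by (simp add: diff_divide_distrib)
      ultimately have "\<bar>(f t - f (M $ l)) / h - b u\<bar> \<le> \<bar>b u' - b u\<bar>"
        by (simp add: abs_divide abs_mult pos_divide_le_eq)
      then show ?case using u' by (simp add: W_def dist_real_def h_def)
    qed
  qed
  then have "(f has_field_derivative b u) (at (M $ l))"
    by (simp add: has_field_derivative_iff)
  then show ?thesis
    unfolding partial_deriv_def f_def[symmetric] b_def[symmetric] by (rule DERIV_imp_deriv)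
qed

section \<open>Failure of strong hyperbolicity\<close>

lemma qmom_matrix_not_diagonalizable:
  assumes q: "quadrature_of N M w u" and N: "N \<ge> 1"
  shows "\<not> diagonalizable (qmom_matrix N M)"
proof -
  have "qmom_matrix N M = mat (2 * N) (2 * N) (\<lambda>(k, l).
          if k = 2 * N - 1 then - coeff (nodal_square N u) l else if l = k + 1 then 1 else 0)"
    unfolding qmom_matrix_def by (intro eq_matI) (auto simp: partial_deriv_closure_moment[OF q])
  moreover have "[:- u 0, 1:]\<^sup>2 dvd nodal_square N u"
    unfolding nodal_square_def using N by (intro dvd_power_same dvd_prodI) auto
  ultimately show ?thesis
    using companion_not_diagonalizable[of "nodal_square N u" "2 * N" "u 0"]
    by (simp add: degree_nodal_square coeff_nodal_square_top)
qed

theorem theorem2p1: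
  fixes N :: nat and \<nu> :: real
  assumes "N \<ge> 1"
  shows "\<not> strongly_hyperbolic (qmom_system N \<nu>)"
proof -
  define M where "M = vec (2 * N) (node_moment N (\<lambda>_. 1) real)"
  have q: "quadrature_of N M (\<lambda>_. 1) real"
    by (auto simp: quadrature_of_def M_def inj_on_def)
  then have "M \<in> state_space (qmom_system N \<nu>)"
    by (auto simp: qmom_system_def qmom_states_def)
  then show ?thesis
    using qmom_matrix_not_diagonalizable[OF q assms]
    by (auto simp: strongly_hyperbolic_def qmom_system_def)
qed

end
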